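(* Let $a_1,\dots,a_m\in\mathbb{R}^n\setminus\{0\}$, $b_1,\dots,b_m\in\mathbb{R}$, and let $\Omega=\bigcap_{j=1}^m\{x\in\mathbb{R}^n\mid\langle a_j,x\rangle\le b_j\}$ be nonempty. Let $I\subset\{1,\dots,n\}$ be a nonempty index set such that $\pi_I(\Omega)$ is unbounded. Then $$T(\infty_I;\Omega)=\{d\in\mathbb{R}^n\mid\langle a_j,d\rangle\le 0\ \text{for all } j\in J^\infty_I(\Omega)\},\qquad N(\infty_I;\Omega)=\sum_{j\in J^\infty_I(\Omega)}\mathbb{R}_+a_j.$$
   Context: $\mathbb{R}^n$ carries the Euclidean inner product and norm. For a nonempty index set $I\subset\{1,\dots,n\}$, $\pi_I(x)=(x_i)_{i\in I}$. For each $j$, $F_j=\{x\in\Omega\mid\langle a_j,x\rangle=b_j\}$, and the asymptotic active index set is $J^\infty_I(\Omega)=\{j\in\{1,\dots,m\}\mid\pi_I(F_j)\text{ is unbounded}\}$. $\mathbb{R}_+=[0,\infty)$; an empty sum of sets is $\{0\}$. Tangent cone at infinity: $T(\infty_I;\Omega)$ is the set of $w\in\mathbb{R}^n$ such that for all sequences $x_k\in\Omega$ with $\|\pi_I(x_k)\|\to\infty$ and all $t_k>0$ with $t_k\to 0$ there exist $w_k\to w$ with $x_k+t_kw_k\in\Omega$ for all $k$. Normal cone at infinity: $N(\infty_I;\Omega)=\{v\mid\langle v,w\rangle\le 0\ \forall w\in T(\infty_I;\Omega)\}$. *)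

theory Defs
  imports "HOL-Analysis.Analysis"
begin

text \<open>
  The space of the vectors indexed by \<open>I\<close> is embedded isometrically into \<open>real ^ 'n\<close> by padding
  with zeros outside \<open>I\<close>, so the library norm of \<open>coord_proj I x\<close> is the Euclidean norm of the
  subvector \<open>(x $ i)\<close> with \<open>i \<in> I\<close>.
\<close>

definition coord_proj :: "'n set \<Rightarrow> real ^ 'n \<Rightarrow> real ^ ('n::finite)" where
  "coord_proj I x = (\<chi> i. if i \<in> I then x $ i else 0)"

definition active_part :: "(nat \<Rightarrow> real ^ ('n::finite)) \<Rightarrow> (nat \<Rightarrow> real) \<Rightarrow> (real ^ 'n) set \<Rightarrow>
    nat \<Rightarrow> (real ^ 'n) set" where
  "active_part a b \<Omega> j = {x \<in> \<Omega>. a j \<bullet> x = b j}"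

definition asymp_active :: "nat \<Rightarrow> (nat \<Rightarrow> real ^ ('n::finite)) \<Rightarrow> (nat \<Rightarrow> real) \<Rightarrow> 'n set \<Rightarrow>
    (real ^ 'n) set \<Rightarrow> nat set" where
  "asymp_active m a b I \<Omega> = {j \<in> {1..m}. \<not> bounded (coord_proj I ` active_part a b \<Omega> j)}"

definition tangent_cone_at_inf :: "'n set \<Rightarrow> (real ^ ('n::finite)) set \<Rightarrow> (real ^ 'n) set" where
  "tangent_cone_at_inf I \<Omega> =
    {w. \<forall>(x :: nat \<Rightarrow> real ^ 'n) (t :: nat \<Rightarrow> real).
          (\<forall>k. x k \<in> \<Omega>) \<and> filterlim (\<lambda>k. norm (coord_proj I (x k))) at_top sequentially \<and>
          (\<forall>k. t k > 0) \<and> t \<longlonglongrightarrow> 0 \<longrightarrow>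
          (\<exists>w' :: nat \<Rightarrow> real ^ 'n. w' \<longlonglongrightarrow> w \<and> (\<forall>k. x k + t k *\<^sub>R w' k \<in> \<Omega>))}"

definition normal_cone_at_inf :: "'n set \<Rightarrow> (real ^ ('n::finite)) set \<Rightarrow> (real ^ 'n) set" where
  "normal_cone_at_inf I \<Omega> = {v. \<forall>w \<in> tangent_cone_at_inf I \<Omega>. v \<bullet> w \<le> 0}"

end

theory Submission
  imports Defs
begin

text \<open>
  The point is that a constraint \<open>j\<close> outside the asymptotic active set has slack
  \<open>b j - a j \<bullet> x\<close> bounded away from \<open>0\<close> as the projection of \<open>x\<close> goes to infinity in \<open>\<Omega>\<close>;
  a fixed direction, scaled by a step tending to \<open>0\<close>, therefore eventually respects it.
  By Farkas' lemma, a linear bound \<open>c \<bullet> x \<le> M\<close> on the face \<open>a j \<bullet> x = b j\<close> extends to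
  \<open>c \<bullet> x \<le> M + \<mu> * (b j - a j \<bullet> x)\<close> on \<open>\<Omega>\<close>. For a nonempty face with bounded projection,
  applying this to the coordinates makes the slack large wherever the projection is; for an
  empty face, \<open>c = 0\<close> and \<open>M = - 1\<close> give \<open>\<mu> * (b j - a j \<bullet> x) \<ge> 1\<close>.
\<close>

section \<open>Farkas' lemma for finitely generated cones and for linear inequalities\<close>

text \<open>A finitely generated cone is closed, so a point outside it can be strictly separated
  from it; the negated separating normal then contradicts \<open>dual\<close>.\<close>

lemma cone_farkas:
  fixes G :: "'a::euclidean_space set"
  assumes "finite G" and dual: "\<And>w. (\<And>g. g \<in> G \<Longrightarrow> g \<bullet> w \<le> 0) \<Longrightarrow> v \<bullet> w \<le> 0"
  shows "v \<in> convex_cone hull G"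
proof (rule ccontr)
  assume "v \<notin> convex_cone hull G"
  then obtain w \<beta> where wv: "w \<bullet> v < \<beta>" and w: "\<And>x. x \<in> convex_cone hull G \<Longrightarrow> w \<bullet> x > \<beta>"
    using separating_hyperplane_closed_point[OF convex_convex_cone_hull closed_convex_cone_hull[OF \<open>finite G\<close>]]
    by blast
  have "\<beta> < 0"
    using w[OF convex_cone_hull_contains_0] by simp
  have "g \<bullet> (- w) \<le> 0" if "g \<in> G" for g
  proof (rule ccontr)
    assume "\<not> g \<bullet> (- w) \<le> 0"
    then have neg: "w \<bullet> g < 0"
      by (simp add: inner_commute)
    \<comment> \<open>The factor puts this multiple of \<open>g\<close> exactly on the separating
      hyperplane, where the strict inequality \<open>w\<close> fails.\<close>
    then have "(\<beta> / (w \<bullet> g)) *\<^sub>R g \<in> convex_cone hull G"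
      using \<open>\<beta> < 0\<close> \<open>g \<in> G\<close> by (intro convex_cone_hull_mul hull_inc) (auto intro: divide_nonpos_neg)
    from w[OF this] neg show False
      by simp
  qed
  from dual[OF this] wv \<open>\<beta> < 0\<close> show False
    by (simp add: inner_commute)
qed

text \<open>The condition \<open>cons\<close> cannot be dropped: for the inconsistent system \<open>G = {(0, - 1)}\<close>
  the hull contains only pairs with first component \<open>0\<close>.\<close>

lemma affine_farkas:
  fixes G :: "('a::euclidean_space \<times> real) set"
  assumes "finite G"
    and cM: "\<And>x. (\<And>a b. (a, b) \<in> G \<Longrightarrow> a \<bullet> x \<le> b) \<Longrightarrow> c \<bullet> x \<le> M"
    and cons: "c = 0 \<or> (\<exists>p. \<forall>(a, b) \<in> G. a \<bullet> p \<le> b)"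
  shows "(c, M) \<in> convex_cone hull (insert (0, 1) G)"
proof (rule cone_farkas)
  show "finite (insert (0, 1) G)"
    using \<open>finite G\<close> by simp
  fix ws :: "'a \<times> real"
  assume dual: "\<And>g. g \<in> insert (0, 1) G \<Longrightarrow> g \<bullet> ws \<le> 0"
  obtain w s where ws: "ws = (w, s)"
    by force
  have "s \<le> 0"
    using dual[of "(0, 1)"] ws by simp
  have G: "a \<bullet> w + b * s \<le> 0" if "(a, b) \<in> G" for a b
    using dual[of "(a, b)"] that ws by simp
  have "c \<bullet> w + M * s \<le> 0"
  \<comment> \<open>For \<open>s < 0\<close>, rescaling \<open>w\<close> gives a solution of the
    system; for \<open>s = 0\<close>, \<open>w\<close> is a recession direction of it.\<close>
  proof (cases "s = 0")
    case False
    then have "s < 0"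
      using \<open>s \<le> 0\<close> by simp
    have "a \<bullet> ((- 1 / s) *\<^sub>R w) \<le> b" if "(a, b) \<in> G" for a b
      using G[OF that] \<open>s < 0\<close> by (simp add: field_simps)
    from cM[OF this] show ?thesis
      using \<open>s < 0\<close> by (simp add: field_simps)
  next
    case True
    have "c \<bullet> w \<le> 0"
    proof (rule ccontr)
      assume pos: "\<not> c \<bullet> w \<le> 0"
      then obtain p where p: "\<And>a b. (a, b) \<in> G \<Longrightarrow> a \<bullet> p \<le> b"
        using cons by fastforce
      \<comment> \<open>Moving from \<open>p\<close> by \<open>r\<close> along \<open>w\<close>
        raises the value of \<open>c\<close> by more than the gap to \<open>M\<close>.\<close>
      define r where "r = (\<bar>M - c \<bullet> p\<bar> + 1) / (c \<bullet> w)"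
      have "r \<ge> 0"
        using pos by (simp add: r_def)
      have "a \<bullet> (p + r *\<^sub>R w) \<le> b" if "(a, b) \<in> G" for a b
        using p[OF that] G[OF that] True mult_nonneg_nonpos[OF \<open>r \<ge> 0\<close>, of "a \<bullet> w"]
        by (simp add: inner_right_distrib)
      from cM[OF this] have "c \<bullet> p + (\<bar>M - c \<bullet> p\<bar> + 1) \<le> M"
        using pos by (simp add: inner_right_distrib r_def)
      then show False
        by linarith
    qed
    then show ?thesis
      using True by simp
  qed
  then show "(c, M) \<bullet> ws \<le> 0"
    using ws by simp
qed

text \<open>The constant \<open>\<mu>\<close> is the Farkas multiplier of the constraint \<open>a \<bullet> x \<ge> b\<close>.\<close>

lemma bound_off_face:
  fixes G :: "('a::euclidean_space \<times> real) set"
  defines "P \<equiv> {x. \<forall>(a, b) \<in> G. a \<bullet> x \<le> b}"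
  assumes "finite G"
    and cM: "\<And>x. x \<in> P \<Longrightarrow> a \<bullet> x \<ge> b \<Longrightarrow> c \<bullet> x \<le> M"
    and cons: "c = 0 \<or> (\<exists>p \<in> P. a \<bullet> p \<ge> b)"
  obtains \<mu> where "\<mu> \<ge> 0" "\<And>x. x \<in> P \<Longrightarrow> c \<bullet> x \<le> M + \<mu> * (b - a \<bullet> x)"
proof -
  have "(c, M) \<in> convex_cone hull (insert (0, 1) (insert (- a, - b) G))"
  proof (rule affine_farkas)
    show "c \<bullet> x \<le> M" if "\<And>a' b'. (a', b') \<in> insert (- a, - b) G \<Longrightarrow> a' \<bullet> x \<le> b'" for x
      using that[of "- a" "- b"] that by (intro cM) (auto simp: P_def)
    show "c = 0 \<or> (\<exists>p. \<forall>(a, b) \<in> insert (- a, - b) G. a \<bullet> p \<le> b)"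
      using cons by (auto simp: P_def)
  qed (use \<open>finite G\<close> in simp)
  then have "(c, M) \<in> convex_cone hull ({(- a, - b)} \<union> insert (0, 1) G)"
    by (simp add: insert_commute)
  then obtain g us where g: "g \<in> convex_cone hull {(- a, - b)}"
    and us: "us \<in> convex_cone hull (insert (0, 1) G)" and sum: "(c, M) = g + us"
    unfolding convex_cone_hull_Un by blast
  obtain \<mu> where \<mu>: "\<mu> \<ge> 0" "g = \<mu> *\<^sub>R (- a, - b)"
    using g by (auto simp: convex_cone_hull_separate_nonempty conic_hull_explicit)
  show thesis
  proof
    fix x assume "x \<in> P"
    \<comment> \<open>Each generator encodes an inequality valid at \<open>x\<close>, and such pairs
      form a half-space cone; hence \<open>us\<close> encodes one too.\<close>
    have "convex_cone hull (insert (0, 1) G) \<subseteq> {y. (x, - 1) \<bullet> y \<le> 0}"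
      using \<open>x \<in> P\<close> by (intro hull_minimal convex_cone_halfspace_le) (auto simp: P_def inner_commute)
    then have "(x, - 1) \<bullet> us \<le> 0"
      using us by blast
    moreover have "us = (c + \<mu> *\<^sub>R a, M + \<mu> * b)"
      using sum \<mu>(2) by (simp add: prod_eq_iff algebra_simps)
    ultimately show "c \<bullet> x \<le> M + \<mu> * (b - a \<bullet> x)"
      by (simp add: inner_commute algebra_simps)
  qed (fact \<mu>(1))
qed

section \<open>Growth of the slack away from a face\<close>

text \<open>Each functional \<open>u \<bullet> f x\<close> is handled by
  \<open>bound_off_face\<close> through the adjoint of \<open>f\<close>; finitely many functionals
  control the norm. The point \<open>p\<close> supplies the consistency needed when
  \<open>adjoint f u\<close> is nonzero.\<close>

lemma linear_image_bound_off_face: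
  fixes G :: "('a::euclidean_space \<times> real) set" and f :: "'a \<Rightarrow> 'b::euclidean_space"
  defines "P \<equiv> {x. \<forall>(a, b) \<in> G. a \<bullet> x \<le> b}"
  assumes "finite G" "linear f"
    and bdd: "bounded (f ` {x \<in> P. a \<bullet> x \<ge> b})"
    and "p \<in> P" "a \<bullet> p \<ge> b"
  obtains A B where "B \<ge> 0"
    "\<And>x. x \<in> P \<Longrightarrow> a \<bullet> x \<le> b \<Longrightarrow> norm (f x) \<le> A + B * (b - a \<bullet> x)"
proof -
  obtain M where M: "\<And>x. x \<in> P \<Longrightarrow> a \<bullet> x \<ge> b \<Longrightarrow> norm (f x) \<le> M"
    using bdd by (auto simp: bounded_iff)
  have "\<exists>\<mu>\<ge>0. \<forall>x\<in>P. u \<bullet> f x \<le> norm u * M + \<mu> * (b - a \<bullet> x)" for u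
  proof (rule bound_off_face[where G = G and a = a and b = b and c = "adjoint f u" and M = "norm u * M", folded P_def])
    show "adjoint f u \<bullet> x \<le> norm u * M" if "x \<in> P" "a \<bullet> x \<ge> b" for x
    proof -
      have "u \<bullet> f x \<le> norm u * norm (f x)"
        by (rule norm_cauchy_schwarz)
      also have "\<dots> \<le> norm u * M"
        using M[OF that] by (simp add: mult_left_mono)
      finally show ?thesis
        by (simp add: adjoint_clauses \<open>linear f\<close>)
    qed
  qed (use assms in \<open>auto simp: adjoint_clauses\<close>)
  then obtain \<mu> where \<mu>: "\<And>u. \<mu> u \<ge> 0"
    "\<And>u x. x \<in> P \<Longrightarrow> u \<bullet> f x \<le> norm u * M + \<mu> u * (b - a \<bullet> x)"
    by metis
  \<comment> \<open>Bounding an absolute value takes both \<open>u\<close> and \<open>- u\<close>;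
    as the slack is nonnegative, the sum of the two multipliers serves for both signs.\<close>
  define B where "B = (\<Sum>u\<in>Basis. \<mu> u + \<mu> (- u))"
  show thesis
  proof
    show "B \<ge> 0"
      using \<mu>(1) by (auto simp: B_def intro!: sum_nonneg add_nonneg_nonneg)
    fix x assume x: "x \<in> P" "a \<bullet> x \<le> b"
    have "\<bar>f x \<bullet> u\<bar> \<le> M + (\<mu> u + \<mu> (- u)) * (b - a \<bullet> x)" if "u \<in> Basis" for u
    proof -
      have "\<mu> u * (b - a \<bullet> x) \<ge> 0" "\<mu> (- u) * (b - a \<bullet> x) \<ge> 0"
        using x \<mu>(1) by auto
      then show ?thesis
        using \<mu>(2)[OF x(1), of u] \<mu>(2)[OF x(1), of "- u"] that
        by (simp add: inner_commute distrib_right abs_le_iff)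
    qed
    then have "(\<Sum>u\<in>Basis. \<bar>f x \<bullet> u\<bar>) \<le> (\<Sum>u\<in>Basis. M + (\<mu> u + \<mu> (- u)) * (b - a \<bullet> x))"
      by (rule sum_mono)
    also have "\<dots> = (\<Sum>u\<in>(Basis :: 'b set). M) + B * (b - a \<bullet> x)"
      unfolding B_def sum_distrib_right by (rule sum.distrib)
    finally show "norm (f x) \<le> (\<Sum>u\<in>(Basis :: 'b set). M) + B * (b - a \<bullet> x)"
      using norm_le_l1[of "f x"] by linarith
  qed
qed

lemma slack_eventually_bounded_below:
  fixes G :: "('a::euclidean_space \<times> real) set" and f :: "'a \<Rightarrow> 'b::euclidean_space"
  defines "P \<equiv> {x. \<forall>(a, b) \<in> G. a \<bullet> x \<le> b}"
  assumes "finite G" "linear f" "(a, b) \<in> G"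
    and bdd: "bounded (f ` {x \<in> P. a \<bullet> x = b})"
    and x: "\<And>k. x k \<in> P" "filterlim (\<lambda>k. norm (f (x k))) at_top F"
  obtains \<delta> where "\<delta> > 0" "\<forall>\<^sub>F k in F. \<delta> \<le> b - a \<bullet> x k"
proof (cases "{x \<in> P. a \<bullet> x = b} = {}")
  case True
  have le: "a \<bullet> y \<le> b" if "y \<in> P" for y
    using that \<open>(a, b) \<in> G\<close> by (auto simp: P_def)
  obtain \<mu> where \<mu>: "\<mu> \<ge> 0" "\<And>y. y \<in> P \<Longrightarrow> 0 \<bullet> y \<le> - 1 + \<mu> * (b - a \<bullet> y)"
  proof (rule bound_off_face[where G = G and a = a and b = b and c = 0 and M = "- 1", folded P_def])
    show "0 \<bullet> y \<le> - (1::real)" if "y \<in> P" "b \<le> a \<bullet> y" for y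
      using that le[of y] True by force
  qed (use \<open>finite G\<close> in auto)
  \<comment> \<open>Enlarging \<open>\<mu>\<close> to \<open>\<mu> + 1\<close> keeps the inequality,
    since the slack is nonnegative, and makes the divisor positive.\<close>
  have "1 / (\<mu> + 1) \<le> b - a \<bullet> x k" for k
    using \<mu>(1) \<mu>(2)[OF x(1)[of k]] le[OF x(1)[of k]] by (simp add: field_simps)
  then show thesis
    using \<mu>(1) by (intro that[of "1 / (\<mu> + 1)"]) auto
next
  case False
  have le: "a \<bullet> y \<le> b" if "y \<in> P" for y
    using that \<open>(a, b) \<in> G\<close> by (auto simp: P_def)
  have face: "{y \<in> P. a \<bullet> y \<ge> b} = {y \<in> P. a \<bullet> y = b}"
    using le by force
  obtain p where "p \<in> P" "a \<bullet> p \<ge> b"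
    using False face by auto
  then obtain A B where AB: "B \<ge> 0" "\<And>y. y \<in> P \<Longrightarrow> norm (f y) \<le> A + B * (b - a \<bullet> y)"
    using linear_image_bound_off_face[where G = G and f = f and a = a and b = b and p = p, folded P_def] assms(2,3) bdd le face by metis
  \<comment> \<open>The threshold \<open>A + B\<close> is the value of the bound at slack 1.\<close>
  have "\<forall>\<^sub>F k in F. norm (f (x k)) > A + B"
    using x(2) by (simp add: filterlim_at_top_dense)
  then have "\<forall>\<^sub>F k in F. 1 \<le> b - a \<bullet> x k"
  proof eventually_elim
    case (elim k)
    then have "B * 1 < B * (b - a \<bullet> x k)"
      using AB(2)[OF x(1)[of k]] by simp
    then have "1 < b - a \<bullet> x k"
      using AB(1) by (rule mult_left_less_imp_less)
    then show ?case
      by simp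
  qed
  then show thesis
    by (intro that[of 1]) auto
qed

lemma linear_coord_proj: "linear (coord_proj I)"
  by (rule linearI) (auto simp: coord_proj_def vec_eq_iff)

text \<open>The hull of a union is the Minkowski sum of the hulls, so generators can be added one at
  a time; repeated values of \<open>a\<close> do no harm.\<close>

lemma convex_cone_hull_image_eq_sum_rays:
  fixes a :: "'i \<Rightarrow> 'a::real_vector"
  assumes "finite J"
  shows "convex_cone hull (a ` J) = (\<Sum>j\<in>J. {r *\<^sub>R a j | r. r \<ge> 0})"
  using assms
proof induction
  case empty
  then show ?case
    by simp
next
  case (insert j J)
  have "convex_cone hull (a ` insert j J) = convex_cone hull ({a j} \<union> a ` J)"
    by simp
  also have "\<dots> = convex_cone hull {a j} + convex_cone hull (a ` J)"
    unfolding convex_cone_hull_Un by (auto simp: set_plus_def)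
  also have "convex_cone hull {a j} = {r *\<^sub>R a j | r. r \<ge> 0}"
    by (auto simp: convex_cone_hull_separate_nonempty conic_hull_explicit)
  finally show ?case
    using insert by simp
qed

lemma unbounded_imp_filterlim_norm:
  assumes "\<not> bounded (f ` S)"
  obtains x :: "nat \<Rightarrow> 'a" where "\<And>k. x k \<in> S" "filterlim (\<lambda>k. norm (f (x k))) at_top sequentially"
proof -
  have "\<exists>y \<in> S. norm (f y) > real k" for k
    using assms by (force simp: bounded_iff not_le)
  then obtain x where x: "\<And>k. x k \<in> S" "\<And>k. norm (f (x k)) > real k"
    by metis
  have "filterlim (\<lambda>k. norm (f (x k))) at_top sequentially"
    by (rule filterlim_at_top_mono[OF filterlim_real_sequentially])
       (use x(2) in \<open>auto intro: always_eventually less_imp_le\<close>)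
  with x(1) that show thesis
    by blast
qed

section \<open>The tangent and normal cones at infinity\<close>

theorem theorem3p13:
  fixes m :: nat
    and a :: "nat \<Rightarrow> real ^ ('n::finite)"
    and b :: "nat \<Rightarrow> real"
    and \<Omega> :: "(real ^ 'n) set"
    and I :: "'n set"
  assumes "\<And>j. j \<in> {1..m} \<Longrightarrow> a j \<noteq> 0"
    and "\<Omega> = (\<Inter>j\<in>{1..m}. {x. a j \<bullet> x \<le> b j})"
    and "\<Omega> \<noteq> {}"
    and "I \<noteq> {}"
    and "\<not> bounded (coord_proj I ` \<Omega>)"
  shows "tangent_cone_at_inf I \<Omega> = {d. \<forall>j \<in> asymp_active m a b I \<Omega>. a j \<bullet> d \<le> 0} \<and>
    normal_cone_at_inf I \<Omega> = (\<Sum>j \<in> asymp_active m a b I \<Omega>. {r *\<^sub>R a j | r. r \<ge> 0})"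
proof
  let ?J = "asymp_active m a b I \<Omega>"
  have fin: "finite ?J"
    by (simp add: asymp_active_def)
  have le: "a j \<bullet> x \<le> b j" if "x \<in> \<Omega>" "j \<in> {1..m}" for x j
    using that by (auto simp: assms(2))
  define G where "G = (\<lambda>j. (a j, b j)) ` {1..m}"
  have \<Omega>: "\<Omega> = {x. \<forall>(a, b) \<in> G. a \<bullet> x \<le> b}"
    by (auto simp: assms(2) G_def)
  show T: "tangent_cone_at_inf I \<Omega> = {d. \<forall>j \<in> ?J. a j \<bullet> d \<le> 0}"
  proof (intro equalityI subsetI CollectI ballI)
    fix w j assume w: "w \<in> tangent_cone_at_inf I \<Omega>" and j: "j \<in> ?J"
    \<comment> \<open>Along a sequence inside the face the constraint has no slack, so every
      admissible \<open>w' k\<close> must satisfy the homogeneous inequality.\<close>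
    obtain x where x: "\<And>k. x k \<in> active_part a b \<Omega> j"
      and lim: "filterlim (\<lambda>k. norm (coord_proj I (x k))) at_top sequentially"
      using j unbounded_imp_filterlim_norm by (auto simp: asymp_active_def)
    define t where "t = (\<lambda>k. inverse (real (Suc k)))"
    have t: "\<And>k. t k > 0" "t \<longlonglongrightarrow> 0"
      unfolding t_def by (simp, rule LIMSEQ_inverse_real_of_nat)
    have "\<exists>w'. w' \<longlonglongrightarrow> w \<and> (\<forall>k. x k + t k *\<^sub>R w' k \<in> \<Omega>)"
      using w[unfolded tangent_cone_at_inf_def mem_Collect_eq, THEN spec[of _ x], THEN spec[of _ t]]
        x lim t by (simp add: active_part_def)
    then obtain w' where w': "w' \<longlonglongrightarrow> w" "\<And>k. x k + t k *\<^sub>R w' k \<in> \<Omega>"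
      by blast
    have "a j \<bullet> w' k \<le> 0" for k
    proof -
      have "t k * (a j \<bullet> w' k) \<le> 0"
        using le[OF w'(2)[of k], of j] x[of k] j
        by (simp add: active_part_def asymp_active_def inner_right_distrib)
      then show ?thesis
        using t(1)[of k] by (simp add: mult_le_0_iff)
    qed
    then show "a j \<bullet> w \<le> 0"
      using w'(1) by (intro tendsto_upperbound[of "\<lambda>k. a j \<bullet> w' k"] tendsto_intros) auto
  next
    fix d assume "d \<in> {d. \<forall>j \<in> ?J. a j \<bullet> d \<le> 0}"
    then have d: "\<And>j. j \<in> ?J \<Longrightarrow> a j \<bullet> d \<le> 0"
      by blast
    have "\<exists>w'. w' \<longlonglongrightarrow> d \<and> (\<forall>k. x k + t k *\<^sub>R w' k \<in> \<Omega>)"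
      if x: "\<forall>k. x k \<in> \<Omega>" "filterlim (\<lambda>k. norm (coord_proj I (x k))) at_top sequentially"
        and t: "\<forall>k. t k > 0" "t \<longlonglongrightarrow> 0" for x :: "nat \<Rightarrow> real ^ 'n" and t :: "nat \<Rightarrow> real"
    proof -
      have "\<forall>\<^sub>F k in sequentially. a j \<bullet> (x k + t k *\<^sub>R d) \<le> b j" if j: "j \<in> {1..m}" for j
      proof (cases "j \<in> ?J")
        case True
        have "a j \<bullet> (x k + t k *\<^sub>R d) \<le> b j" for k
          using le[OF x(1)[rule_format, of k] j] mult_nonneg_nonpos[OF less_imp_le d[OF True], of "t k"] t(1)
          by (simp add: inner_right_distrib)
        then show ?thesis
          by simp
      next
        case False
        then have "bounded (coord_proj I ` {x \<in> \<Omega>. a j \<bullet> x = b j})"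
          using j by (simp add: asymp_active_def active_part_def)
        then obtain \<delta> where \<delta>: "\<delta> > 0" "\<forall>\<^sub>F k in sequentially. \<delta> \<le> b j - a j \<bullet> x k"
          using slack_eventually_bounded_below[where G = G and f = "coord_proj I" and a = "a j" and b = "b j" and x = x
              and F = sequentially, folded \<Omega>]
            j x linear_coord_proj by (auto simp: G_def)
        have "(\<lambda>k. t k * (a j \<bullet> d)) \<longlonglongrightarrow> 0"
          using tendsto_mult_left_zero[OF t(2)] .
        then have "\<forall>\<^sub>F k in sequentially. t k * (a j \<bullet> d) < \<delta>"
          using \<delta>(1) by (rule order_tendstoD)
        with \<delta>(2) show ?thesis
          by eventually_elim (simp add: inner_right_distrib)
      qed
      \<comment> \<open>There are only finitely many constraints, so a common tail satisfies all of
        them.\<close>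
      then have ev: "\<forall>\<^sub>F k in sequentially. x k + t k *\<^sub>R d \<in> \<Omega>"
        by (simp add: assms(2) eventually_ball_finite_distrib)
      \<comment> \<open>Tangency asks for feasibility at every \<open>k\<close>; before the tail the
        direction 0 is used, which stays at \<open>x k\<close>.\<close>
      let ?w = "\<lambda>k. if x k + t k *\<^sub>R d \<in> \<Omega> then d else 0"
      have "?w \<longlonglongrightarrow> d"
        by (rule tendsto_eventually, rule eventually_mono[OF ev]) simp
      moreover have "\<forall>k. x k + t k *\<^sub>R ?w k \<in> \<Omega>"
        using x(1) by simp
      ultimately show ?thesis
        by blast
    qed
    then show "d \<in> tangent_cone_at_inf I \<Omega>"
      by (simp add: tangent_cone_at_inf_def)
  qed
  have "normal_cone_at_inf I \<Omega> = convex_cone hull (a ` ?J)"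
  proof (intro equalityI subsetI)
    fix v assume "v \<in> normal_cone_at_inf I \<Omega>"
    \<comment> \<open>By \<open>T\<close>, the tangent vectors are exactly the test vectors in the
      premise of \<open>cone_farkas\<close>.\<close>
    then show "v \<in> convex_cone hull (a ` ?J)"
      using fin by (intro cone_farkas) (auto simp: normal_cone_at_inf_def T)
  next
    fix v assume v: "v \<in> convex_cone hull (a ` ?J)"
    show "v \<in> normal_cone_at_inf I \<Omega>"
      unfolding normal_cone_at_inf_def
    proof (intro CollectI ballI)
      fix w assume "w \<in> tangent_cone_at_inf I \<Omega>"
      then have "convex_cone hull (a ` ?J) \<subseteq> {v. w \<bullet> v \<le> 0}"
        by (intro hull_minimal convex_cone_halfspace_le) (auto simp: T inner_commute)
      with v show "v \<bullet> w \<le> 0"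
        by (auto simp: inner_commute)
    qed
  qed
  then show "normal_cone_at_inf I \<Omega> = (\<Sum>j \<in> ?J. {r *\<^sub>R a j | r. r \<ge> 0})"
    by (simp add: convex_cone_hull_image_eq_sum_rays fin)
qed

end
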